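(* For all integers $n\geq 0$, $p_{\mathrm{eu}}^{\mathrm{ou}}(n)\leq p^{\mathrm{eu}}_{\mathrm{ou}}(n)$. Moreover, $p_{\mathrm{eu}}^{\mathrm{ou}}(n)< p^{\mathrm{eu}}_{\mathrm{ou}}(n)$ for all $n\geq 3$.
   Context: A partition of a non-negative integer $n$ is a non-increasing (finite, possibly empty) sequence of positive integers, called parts, summing to $n$. $p_{\mathrm{eu}}^{\mathrm{ou}}(n)$ is the number of partitions of $n$ in which every odd part is larger than every even part (no restriction on multiplicities of parts). $p^{\mathrm{eu}}_{\mathrm{ou}}(n)$ is the number of partitions of $n$ in which every even part is larger than every odd part (no restriction on multiplicities of parts). In both cases partitions with no even parts or with no odd parts are allowed. *)

theory Defs
  imports Main
begin

definition partitions :: "nat \<Rightarrow> nat list set" where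
  "partitions n = {xs. sorted_wrt (\<ge>) xs \<and> (\<forall>x\<in>set xs. 0 < x) \<and> sum_list xs = n}"

text \<open>
  The first word of a name is the parity of the larger parts: in \<open>p_odd_over_even\<close> every odd part
  exceeds every even part. Partitions lacking parts of one parity satisfy either condition vacuously.
\<close>

definition p_odd_over_even :: "nat \<Rightarrow> nat" where
  "p_odd_over_even n =
     card {xs \<in> partitions n. \<forall>a\<in>set xs. \<forall>b\<in>set xs. odd a \<and> even b \<longrightarrow> b < a}"

definition p_even_over_odd :: "nat \<Rightarrow> nat" where
  "p_even_over_odd n =
     card {xs \<in> partitions n. \<forall>a\<in>set xs. \<forall>b\<in>set xs. even a \<and> odd b \<longrightarrow> b < a}"

text \<open>Finiteness, so that the cardinalities above are genuine counts.\<close>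

lemma finite_partitions: "finite (partitions n)"
proof (rule finite_subset)
  have len: "length xs \<le> sum_list xs" if "\<forall>x\<in>set xs. 0 < x" for xs :: "nat list"
    using that by (induction xs) auto
  show "partitions n \<subseteq> {xs. set xs \<subseteq> {..n} \<and> length xs \<le> n}"
    using len by (auto simp: partitions_def dest: member_le_sum_list)
  show "finite {xs. set xs \<subseteq> {..n} \<and> length xs \<le> n}"
    by (rule finite_lists_length_le) simp
qed

end

theory Submission
  imports Defs
begin

text \<open>
  Subtract 1 from every odd part and add as many new parts 1 instead. If the odd parts exceed the
  even ones, this is reversible: if the result has \<open>j\<close> parts 1, drop them and increase the \<open>j\<close>
  largest remaining parts by 1, after padding with parts 0. The resulting partitions have no odd
  part except 1, so their even parts exceed the odd ones. For \<open>n \<ge> 3\<close> they miss the partition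
  \<open>(n)\<close> or \<open>(n - 1, 1)\<close>, according to the parity of \<open>n\<close>.
\<close>

definition odd_to_ones :: "nat list \<Rightarrow> nat list" where
  "odd_to_ones xs = filter (\<lambda>x. 0 < x) (map (\<lambda>x. 2 * (x div 2)) xs) @
     replicate (length (filter odd xs)) 1"

text \<open>The clause for \<open>[]\<close> reads the list as continued by zeros, so that parts 1,
  rounded down to 0 and filtered out, come back.\<close>

fun increase_first :: "nat \<Rightarrow> nat list \<Rightarrow> nat list" where
  "increase_first 0 xs = xs"
| "increase_first (Suc j) [] = 1 # increase_first j []"
| "increase_first (Suc j) (x # xs) = Suc x # increase_first j xs"

text \<open>The odd parts form a prefix of \<open>xs\<close>, so the entries increased are exactly
  those that were decreased. The filter removes only a final run of zeros and thus shifts no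
  position.\<close>

lemma increase_first_halves:
  assumes "sorted_wrt (\<ge>) xs" "\<forall>x\<in>set xs. 0 < x"
    and "\<forall>a\<in>set xs. \<forall>b\<in>set xs. odd a \<and> even b \<longrightarrow> b < a"
  shows "increase_first (length (filter odd xs))
    (filter (\<lambda>x. 0 < x) (map (\<lambda>x. 2 * (x div 2)) xs)) = xs"
  using assms
proof (induction xs)
  case Nil
  then show ?case by simp
next
  case (Cons x xs)
  have IH: "increase_first (length (filter odd xs))
    (filter (\<lambda>x. 0 < x) (map (\<lambda>x. 2 * (x div 2)) xs)) = xs"
    using Cons by simp
  consider "even x" | "x = 1" | "odd x" "1 < x"
    using Cons.prems(2) by (cases "x = 1") (auto elim: oddE)
  then show ?case
  proof cases
    case 1
    \<comment> \<open>An odd part after \<open>x\<close> would be at most \<open>x\<close> by the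
      order, yet larger by the parity condition.\<close>
    have evens: "even y" if "y \<in> set xs" for y
      using Cons.prems 1 that by fastforce
    then have "filter odd xs = []"
      by (simp add: filter_empty_conv)
    with IH 1 Cons.prems(2) show ?thesis
      by simp
  next
    case 2
    \<comment> \<open>All later parts are at most 1, so nothing survives the filter.\<close>
    have "y div 2 = 0" if "y \<in> set xs" for y
      using Cons.prems(1) 2 that by auto
    then have "filter (\<lambda>x. 0 < x) (map (\<lambda>x. 2 * (x div 2)) xs) = []"
      by (auto simp: filter_empty_conv)
    with IH 2 show ?thesis
      by simp
  next
    case 3
    with IH show ?thesis
      by simp
  qed
qed

text \<open>Parity separates the appended ones from the rounded parts, so both arguments of
  \<open>increase_first\<close> can be read off the image alone.\<close>

lemma filter_odd_odd_to_ones: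
  "filter odd (odd_to_ones xs) = replicate (length (filter odd xs)) 1"
  by (simp add: odd_to_ones_def filter_empty_conv)

lemma filter_even_odd_to_ones:
  "filter even (odd_to_ones xs) = filter (\<lambda>x. 0 < x) (map (\<lambda>x. 2 * (x div 2)) xs)"
proof -
  have "filter even (filter (\<lambda>x. 0 < x) (map (\<lambda>x. 2 * (x div 2)) xs)) =
    filter (\<lambda>x. 0 < x) (map (\<lambda>x. 2 * (x div 2)) xs)"
    by (rule filter_True) auto
  then show ?thesis
    by (simp add: odd_to_ones_def)
qed

lemma inj_on_odd_to_ones:
  "inj_on odd_to_ones
     {xs \<in> partitions n. \<forall>a\<in>set xs. \<forall>b\<in>set xs. odd a \<and> even b \<longrightarrow> b < a}"
proof (rule inj_on_inverseI)
  fix xs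
  assume "xs \<in> {xs \<in> partitions n. \<forall>a\<in>set xs. \<forall>b\<in>set xs. odd a \<and> even b \<longrightarrow> b < a}"
  then show "increase_first (length (filter odd (odd_to_ones xs)))
      (filter even (odd_to_ones xs)) = xs"
    unfolding filter_odd_odd_to_ones filter_even_odd_to_ones length_replicate
    by (intro increase_first_halves) (auto simp: partitions_def)
qed

text \<open>This yields the order condition on the image, as positive even parts exceed 1, and also
  a test for lists outside the image.\<close>

lemma odd_mem_odd_to_ones: "a \<in> set (odd_to_ones xs) \<Longrightarrow> odd a \<Longrightarrow> a = 1"
  by (auto simp: odd_to_ones_def split: if_splits)

lemma sum_list_odd_to_ones: "sum_list (odd_to_ones xs) = sum_list xs"
proof (induction xs)
  case Nil
  then show ?case by (simp add: odd_to_ones_def)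
next
  case (Cons x xs)
  \<comment> \<open>The unit that an odd part loses in rounding is returned by its new part
    1.\<close>
  have "x = 2 * (x div 2) + (if odd x then 1 else 0)"
    by (simp add: odd_two_times_div_two_succ)
  with Cons show ?case
    by (auto simp: odd_to_ones_def sum_list_replicate)
qed

lemma odd_to_ones_in_partitions:
  assumes "xs \<in> partitions n"
  shows "odd_to_ones xs \<in> partitions n"
proof -
  have "sorted_wrt (\<ge>) (map (\<lambda>x. 2 * (x div 2)) xs)"
    unfolding sorted_wrt_map
    by (rule sorted_wrt_mono_rel[of _ "(\<ge>)"])
      (use assms in \<open>auto simp: partitions_def intro: div_le_mono\<close>)
  moreover have "sorted_wrt (\<ge>) (replicate k (1 :: nat))" for k
    by (induction k) auto
  \<comment> \<open>Rounded parts kept by the filter are at least 1, so the ones may follow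
    them.\<close>
  ultimately have "sorted_wrt (\<ge>) (odd_to_ones xs)"
    by (auto simp: odd_to_ones_def sorted_wrt_append sorted_wrt_filter simp del: sorted_wrt_map)
  moreover have "\<forall>x\<in>set (odd_to_ones xs). 0 < x"
    by (auto simp: odd_to_ones_def)
  ultimately show ?thesis
    using assms sum_list_odd_to_ones[of xs] by (simp add: partitions_def)
qed

lemma odd_to_ones_even_over_odd:
  assumes "xs \<in> partitions n"
  shows "odd_to_ones xs \<in>
    {xs \<in> partitions n. \<forall>a\<in>set xs. \<forall>b\<in>set xs. even a \<and> odd b \<longrightarrow> b < a}"
proof -
  have "b < a" if "a \<in> set (odd_to_ones xs)" "b \<in> set (odd_to_ones xs)" "even a" "odd b" for a b
  proof -
    have "0 < a"
      using that odd_to_ones_in_partitions[OF assms] by (simp add: partitions_def)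
    with \<open>even a\<close> have "1 < a"
      by (cases "a = 1") auto
    with that show ?thesis
      using odd_mem_odd_to_ones by blast
  qed
  with odd_to_ones_in_partitions[OF assms] show ?thesis
    by blast
qed

theorem theorem3p3:
  shows "(\<forall>n::nat. p_odd_over_even n \<le> p_even_over_odd n) \<and>
         (\<forall>n::nat. n \<ge> 3 \<longrightarrow> p_odd_over_even n < p_even_over_odd n)"
proof (intro conjI allI impI)
  fix n :: nat
  let ?A = "{xs \<in> partitions n. \<forall>a\<in>set xs. \<forall>b\<in>set xs. odd a \<and> even b \<longrightarrow> b < a}"
  let ?B = "{xs \<in> partitions n. \<forall>a\<in>set xs. \<forall>b\<in>set xs. even a \<and> odd b \<longrightarrow> b < a}"
  have fin: "finite ?B"
    by (simp add: finite_partitions)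
  have sub: "odd_to_ones ` ?A \<subseteq> ?B"
    using odd_to_ones_even_over_odd by blast
  have card: "card (odd_to_ones ` ?A) = p_odd_over_even n"
    by (simp add: card_image[OF inj_on_odd_to_ones] p_odd_over_even_def)
  show "p_odd_over_even n \<le> p_even_over_odd n"
    using card_mono[OF fin sub] by (simp add: card p_even_over_odd_def)
  assume n: "3 \<le> n"
  \<comment> \<open>Both witnesses have only odd parts, so they lie in \<open>?B\<close> vacuously.
    If \<open>n\<close> is even, then \<open>n\<close> is at least 4 and \<open>n - 1\<close> is not
    1.\<close>
  obtain ys a where ys: "ys \<in> ?B" "a \<in> set ys" "odd a" "a \<noteq> 1"
  proof (cases "odd n")
    case True
    then show ?thesis
      using n by (intro that[of "[n]" n]) (auto simp: partitions_def)
  next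
    case False
    then show ?thesis
      using n by (intro that[of "[n - 1, 1]" "n - 1"]) (auto simp: partitions_def)
  qed
  then have "ys \<notin> odd_to_ones ` ?A"
    using odd_mem_odd_to_ones by blast
  with sub ys(1) have "odd_to_ones ` ?A \<subset> ?B"
    by blast
  from psubset_card_mono[OF fin this] show "p_odd_over_even n < p_even_over_odd n"
    by (simp add: card p_even_over_odd_def)
qed

end
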